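(* Let $a,b\in\mathbb{Z}\setminus\{0\}$. If $(p,q,r,s)\in\{(2,4,8,8),(2,8,4,8)\}$, then the Diophantine equation $a(x^p-y^q)=b(z^r-w^s)$ has infinitely many non-trivial solutions in coprime polynomials $x,y,z,w\in\mathbb{Z}[t]$.
   Context: A solution is called trivial if both sides vanish separately for trivial reasons (e.g. $x^p=y^q$ and $z^r=w^s$); such solutions are discarded. "Coprime polynomials" means $\gcd(x,y,z,w)=1$ in $\mathbb{Z}[t]$. *)

theory Defs
  imports "HOL-Computational_Algebra.Polynomial_Factorial"
begin

definition is_solution ::
  "int \<Rightarrow> int \<Rightarrow> nat \<Rightarrow> nat \<Rightarrow> nat \<Rightarrow> nat \<Rightarrow> int poly \<Rightarrow> int poly \<Rightarrow> int poly \<Rightarrow> int poly \<Rightarrow> bool"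
  where "is_solution a b p q r s x y z w \<longleftrightarrow> smult a (x ^ p - y ^ q) = smult b (z ^ r - w ^ s)"

text \<open>Both sides of the equation vanish separately. This depends only on the exponents,
  as the coefficients of the equation are nonzero.\<close>

definition trivial_solution ::
  "nat \<Rightarrow> nat \<Rightarrow> nat \<Rightarrow> nat \<Rightarrow> int poly \<Rightarrow> int poly \<Rightarrow> int poly \<Rightarrow> int poly \<Rightarrow> bool"
  where "trivial_solution p q r s x y z w \<longleftrightarrow> x ^ p = y ^ q \<and> z ^ r = w ^ s"

text \<open>The gcd is taken in \<open>\<int>[t]\<close>, so common constant factors are excluded as well; the
  polynomials need not be pairwise coprime.\<close>

definition coprime4 :: "int poly \<Rightarrow> int poly \<Rightarrow> int poly \<Rightarrow> int poly \<Rightarrow> bool"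
  where "coprime4 x y z w \<longleftrightarrow> gcd x (gcd y (gcd z w)) = 1"

end

theory Submission
  imports Defs
begin

text \<open>
  Write \<open>N = b / a\<close>. In the case \<open>(2, 4, 8, 8)\<close> put \<open>x + y\<^sup>2 = u\<^sup>2 (z\<^sup>4 + w\<^sup>4)\<close> and
  \<open>x - y\<^sup>2 = (N / u\<^sup>2) (z\<^sup>4 - w\<^sup>4)\<close>. For fixed \<open>u\<close> this is the genus one curve
  \<open>2 (u y)\<^sup>2 = (u\<^sup>4 - N) z\<^sup>4 + (u\<^sup>4 + N) w\<^sup>4\<close>, which contains the trivial point
  \<open>z = w = 1\<close>, \<open>y = u\<close>. The parabola meeting it to third order there meets it in one further
  point, whose coordinates are polynomials in \<open>k = u\<^sup>4 / N\<close>. In the case \<open>(2, 8, 4, 8)\<close> put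
  \<open>x + y\<^sup>4 = u\<^sup>4 (z\<^sup>2 + w\<^sup>4)\<close> and \<open>x - y\<^sup>4 = (N / u\<^sup>4) (z\<^sup>2 - w\<^sup>4)\<close> and do the same with
  \<open>k = u\<^sup>8 / N\<close>. Taking for \<open>u\<close> a suitable integer multiple of \<open>t\<^sup>n\<close> makes everything integral,
  and in the second case makes \<open>w\<close> a unit modulo \<open>u\<close> and modulo \<open>2\<close>, whence coprimality.
\<close>

text \<open>Both sides are products of conjugate factors, matched as
  \<open>k * (H - G^2) = z^4 - w^4\<close> and \<open>H + G^2 = z^4 + w^4\<close>. Eliminating
  \<open>H\<close> leaves the curve \<open>2*k*G^2 = (k - 1)*z^4 + (k + 1)*w^4\<close>. The scaling
  by \<open>u\<close> is removed here.\<close>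

lemma identity_2488:
  fixes k :: "'a :: comm_ring_1"
  shows "k * ((16*k^8 + 128*k^6 - 88*k^4 + 32*k^2 - 7)^2 - (4*k^4 - 3)^4) =
    (2*k^2 + 2*k - 1)^8 - (2*k^2 - 2*k - 1)^8"
proof -
  define H G z w where "H = 16*k^8 + 128*k^6 - 88*k^4 + 32*k^2 - 7" and "G = 4*k^4 - 3"
    and "z = 2*k^2 + 2*k - 1" and "w = 2*k^2 - 2*k - 1"
  have minus: "k * (H - G^2) = z^4 - w^4"
    unfolding H_def G_def z_def w_def by (simp add: algebra_simps power_numeral_reduce)
  have plus: "H + G^2 = z^4 + w^4"
    unfolding H_def G_def z_def w_def by (simp add: algebra_simps power_numeral_reduce)
  have "k * (H^2 - G^4) = (k * (H - G^2)) * (H + G^2)"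
    by (simp add: algebra_simps power_numeral_reduce)
  also have "\<dots> = z^8 - w^8"
    unfolding minus plus by (simp add: algebra_simps power_numeral_reduce)
  finally show ?thesis
    unfolding H_def G_def z_def w_def .
qed

text \<open>The same matching of conjugate factors; eliminating \<open>H\<close> now leaves
  \<open>2*k*G^4 = (k - 1)*z^2 + (k + 1)*w^4\<close>.\<close>

lemma identity_2848:
  fixes k :: "'a :: comm_ring_1"
  shows "k * ((28561*k^8 + 109848*k^7 + 172604*k^6 + 155112*k^5 + 101126*k^4 + 18984*k^3
      + 3068*k^2 + 600*k - 79)^2 - (13*k^2 + 6*k - 3)^8) =
    (239*k^4 + 340*k^3 + 138*k^2 + 52*k - 1)^4 - (k^2 + 14*k + 1)^8"
proof -
  define H G z w where "H = 28561*k^8 + 109848*k^7 + 172604*k^6 + 155112*k^5 + 101126*k^4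
      + 18984*k^3 + 3068*k^2 + 600*k - 79" and "G = 13*k^2 + 6*k - 3"
    and "z = 239*k^4 + 340*k^3 + 138*k^2 + 52*k - 1" and "w = k^2 + 14*k + 1"
  have minus: "k * (H - G^4) = z^2 - w^4"
    unfolding H_def G_def z_def w_def by (simp add: algebra_simps power_numeral_reduce)
  have plus: "H + G^4 = z^2 + w^4"
    unfolding H_def G_def z_def w_def by (simp add: algebra_simps power_numeral_reduce)
  have "k * (H^2 - G^8) = (k * (H - G^4)) * (H + G^4)"
    by (simp add: algebra_simps power_numeral_reduce)
  also have "\<dots> = z^4 - w^8"
    unfolding minus plus by (simp add: algebra_simps power_numeral_reduce)
  finally show ?thesis
    unfolding H_def G_def z_def w_def .
qed

lemma coprime_2488:
  fixes k :: "'a :: ring_gcd"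
  shows "coprime (2*k^2 + 2*k - 1) (2*k^2 - 2*k - 1)" (is "coprime ?z ?w")
proof (rule coprimeI)
  fix d assume "d dvd ?z" "d dvd ?w"
  \<comment> \<open>Since \<open>?z - ?w = 4*k\<close> and \<open>?z + ?w = 4*k^2 - 2\<close>, the
    bracket equals 2, while \<open>?z = 2*(k^2 + k) - 1\<close>.\<close>
  then have "d dvd (k^2 + k) * (k * (?z - ?w) - (?z + ?w)) - ?z"
    by (meson dvd_diff dvd_mult dvd_add)
  also have "(k^2 + k) * (k * (?z - ?w) - (?z + ?w)) - ?z = 1"
    by (simp add: algebra_simps power_numeral_reduce)
  finally show "d dvd 1" .
qed

lemma coprime_2848:
  fixes k u :: "'a :: ring_gcd"
  assumes "2 dvd k" "u dvd k"
  shows "coprime (u * (13*k^2 + 6*k - 3)) (k^2 + 14*k + 1)" (is "coprime (u * ?f) ?g")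
proof -
  have divisor_of_k: "coprime v ?g" if "v dvd k" for v
  proof (rule coprimeI)
    fix d assume "d dvd v" "d dvd ?g"
    then have "d dvd ?g - (k + 14) * k"
      using that by (meson dvd_diff dvd_mult dvd_trans)
    also have "?g - (k + 14) * k = 1"
      by (simp add: algebra_simps power_numeral_reduce)
    finally show "d dvd 1" .
  qed
  have "coprime ?f ?g"
  proof (rule coprimeI)
    fix d assume d: "d dvd ?f" "d dvd ?g"
    \<comment> \<open>Euclid's algorithm: \<open>13 * ?g - ?f = 16*(11*k + 1)\<close> and
      \<open>121 * ?g = (11*k + 153)*(11*k + 1) - 32\<close>. So only powers of 2 can obstruct
      coprimality, and \<open>?g\<close> is 1 modulo 2 because \<open>2 dvd k\<close>.\<close>
    then have "d dvd (11*k + 153) * (13 * ?g - ?f) - 1936 * ?g"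
      by (meson dvd_diff dvd_mult)
    also have "(11*k + 153) * (13 * ?g - ?f) - 1936 * ?g = 2 ^ 9"
      by (simp add: algebra_simps power_numeral_reduce)
    finally have "d dvd 2 ^ 9" .
    moreover have "coprime (2 ^ 9) ?g"
      using divisor_of_k[OF assms(1)] by (simp only: coprime_power_left_iff simp_thms)
    ultimately show "d dvd 1"
      using d(2) coprime_common_divisor by blast
  qed
  then show ?thesis
    using divisor_of_k[OF assms(2)] by (simp only: coprime_mult_left_iff)
qed

lemma coprime4I_zw: "coprime z w \<Longrightarrow> coprime4 x y z w"
  unfolding coprime4_def by simp

lemma coprime4I_yw: "coprime y w \<Longrightarrow> coprime4 x y z w"
  unfolding coprime4_def by (simp add: gcd.left_commute[of y])

text \<open>The assumption says \<open>k = u^4 / N\<close> without denominators. With weights 2 for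
  \<open>x\<close> and 1 for \<open>y\<close>, the left side gains exactly the factor
  \<open>u^4\<close>, which is traded for \<open>k\<close>.\<close>

lemma is_solution_2488:
  assumes "smult a (u^4) = smult b k"
  shows "is_solution a b 2 4 8 8
    (u^2 * (16*k^8 + 128*k^6 - 88*k^4 + 32*k^2 - 7)) (u * (4*k^4 - 3))
    (2*k^2 + 2*k - 1) (2*k^2 - 2*k - 1)"
    (is "is_solution _ _ _ _ _ _ (u^2 * ?H) (u * ?G) ?z ?w")
proof -
  have "(u^2 * H)^2 - (u * G)^4 = u^4 * (H^2 - G^4)" for H G
    by (simp add: power_mult_distrib right_diff_distrib flip: power_mult)
  then have "smult a ((u^2 * ?H)^2 - (u * ?G)^4) = smult a (u^4) * (?H^2 - ?G^4)"
    by (simp only: mult_smult_left)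
  also have "\<dots> = smult b (?z^8 - ?w^8)"
    unfolding assms identity_2488[symmetric] by (simp only: mult_smult_left)
  finally show ?thesis
    unfolding is_solution_def .
qed

lemma is_solution_2848:
  assumes "smult a (u^8) = smult b k"
  shows "is_solution a b 2 8 4 8
    (u^4 * (28561*k^8 + 109848*k^7 + 172604*k^6 + 155112*k^5 + 101126*k^4 + 18984*k^3
      + 3068*k^2 + 600*k - 79)) (u * (13*k^2 + 6*k - 3))
    (239*k^4 + 340*k^3 + 138*k^2 + 52*k - 1) (k^2 + 14*k + 1)"
    (is "is_solution _ _ _ _ _ _ (u^4 * ?H) (u * ?G) ?z ?w")
proof -
  have "(u^4 * H)^2 - (u * G)^8 = u^8 * (H^2 - G^8)" for H G
    by (simp add: power_mult_distrib right_diff_distrib flip: power_mult)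
  then have "smult a ((u^4 * ?H)^2 - (u * ?G)^8) = smult a (u^8) * (?H^2 - ?G^8)"
    by (simp only: mult_smult_left)
  also have "\<dots> = smult b (?z^4 - ?w^8)"
    unfolding assms identity_2848[symmetric] by (simp only: mult_smult_left)
  finally show ?thesis
    unfolding is_solution_def .
qed

lemma nontrivial_2488:
  assumes "u \<noteq> 0" "poly k 0 = 0"
  shows "\<not> trivial_solution 2 4 8 8
    (u^2 * (16*k^8 + 128*k^6 - 88*k^4 + 32*k^2 - 7)) (u * (4*k^4 - 3)) z w"
    (is "\<not> trivial_solution _ _ _ _ (u^2 * ?H) (u * ?G) _ _")
proof
  assume "trivial_solution 2 4 8 8 (u^2 * ?H) (u * ?G) z w"
  then have "(u^2 * ?H)^2 = (u * ?G)^4"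
    unfolding trivial_solution_def by (rule conjunct1)
  then have "u^4 * ?H^2 = u^4 * ?G^4"
    by (simp only: power_mult_distrib power_mult[symmetric]) simp
  then have "?H^2 = ?G^4"
    using assms(1) by (simp only: mult_cancel_left) simp
  \<comment> \<open>At 0 the values of \<open>?H\<close> and \<open>?G\<close> are -7 and -3, but 49
    is not 81.\<close>
  then have "poly (?H^2) 0 = poly (?G^4) 0"
    by (rule arg_cong)
  then show False
    using assms(2) by simp
qed

lemma nontrivial_2848:
  assumes "u \<noteq> 0" "poly k 0 = 0"
  shows "\<not> trivial_solution 2 8 4 8
    (u^4 * (28561*k^8 + 109848*k^7 + 172604*k^6 + 155112*k^5 + 101126*k^4 + 18984*k^3
      + 3068*k^2 + 600*k - 79)) (u * (13*k^2 + 6*k - 3)) z w"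
    (is "\<not> trivial_solution _ _ _ _ (u^4 * ?H) (u * ?G) _ _")
proof
  assume "trivial_solution 2 8 4 8 (u^4 * ?H) (u * ?G) z w"
  then have "(u^4 * ?H)^2 = (u * ?G)^8"
    unfolding trivial_solution_def by (rule conjunct1)
  then have "u^8 * ?H^2 = u^8 * ?G^8"
    by (simp only: power_mult_distrib power_mult[symmetric]) simp
  then have "?H^2 = ?G^8"
    using assms(1) by (simp only: mult_cancel_left) simp
  \<comment> \<open>At 0 the values are -79 and -3, but 6241 is not 6561.\<close>
  then have "poly (?H^2) 0 = poly (?G^8) 0"
    by (rule arg_cong)
  then show False
    using assms(2) by simp
qed

lemma infinite_solutions_2488:
  fixes a b :: int
  assumes "a \<noteq> 0" "b \<noteq> 0"
  shows "infinite {(x, y, z, w). is_solution a b 2 4 8 8 x y z w \<and>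
    \<not> trivial_solution 2 4 8 8 x y z w \<and> coprime4 x y z w}" (is "infinite ?S")
proof -
  \<comment> \<open>The factor \<open>b\<close> in \<open>u\<close> makes \<open>a * u^4 / b\<close>
    integral; \<open>Suc n\<close> makes \<open>k n\<close> vanish at 0.\<close>
  define u k where "u n = monom b (Suc n)" and "k n = monom (a * b^3) (4 * Suc n)" for n
  define sol where "sol n = (u n^2 * (16*k n^8 + 128*k n^6 - 88*k n^4 + 32*k n^2 - 7),
    u n * (4*k n^4 - 3), 2*k n^2 + 2*k n - 1, 2*k n^2 - 2*k n - 1)" for n
  have "a * b^4 = b * (a * b^3)"
    by algebra
  then have "smult a (u n^4) = smult b (k n)" for n
    by (simp add: u_def k_def monom_power smult_monom algebra_simps)
  moreover have "u n \<noteq> 0" "poly (k n) 0 = 0" for n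
    using assms by (simp_all add: u_def k_def poly_monom)
  ultimately have "sol n \<in> ?S" for n
    unfolding sol_def mem_Collect_eq prod.case
    by (intro conjI is_solution_2488 nontrivial_2488 coprime4I_zw coprime_2488)
  then have "range sol \<subseteq> ?S"
    by (rule image_subsetI)
  moreover have "inj sol"
  proof (rule injI)
    fix m n assume "sol m = sol n"
    \<comment> \<open>The difference \<open>z - w = 4*k\<close> recovers \<open>k\<close>, whose
      degree determines the index.\<close>
    then have "2*k m^2 + 2*k m - 1 - (2*k m^2 - 2*k m - 1)
        = 2*k n^2 + 2*k n - 1 - (2*k n^2 - 2*k n - 1)"
      by (simp only: sol_def prod.inject)
    then have "4 * k m = 4 * k n"
      by algebra
    then have "degree (k m) = degree (k n)"
      by simp
    then show "m = n"
      using assms by (simp add: k_def degree_monom_eq)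
  qed
  ultimately show ?thesis
    using finite_subset range_inj_infinite by blast
qed

lemma infinite_solutions_2848:
  fixes a b :: int
  assumes "a \<noteq> 0" "b \<noteq> 0"
  shows "infinite {(x, y, z, w). is_solution a b 2 8 4 8 x y z w \<and>
    \<not> trivial_solution 2 8 4 8 x y z w \<and> coprime4 x y z w}" (is "infinite ?S")
proof -
  \<comment> \<open>Here \<open>k = a * u^8 / b\<close>; the extra factor 2 in \<open>u\<close>
    makes \<open>k\<close> even, as coprimality requires.\<close>
  define u k where "u n = monom (2 * b) (Suc n)"
    and "k n = monom (2^8 * a * b^7) (8 * Suc n)" for n
  define sol where "sol n = (u n^4 * (28561*k n^8 + 109848*k n^7 + 172604*k n^6 + 155112*k n^5
      + 101126*k n^4 + 18984*k n^3 + 3068*k n^2 + 600*k n - 79), u n * (13*k n^2 + 6*k n - 3),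
    239*k n^4 + 340*k n^3 + 138*k n^2 + 52*k n - 1, k n^2 + 14*k n + 1)" for n
  have "a * (2 * b)^8 = b * (2^8 * a * b^7)"
    by algebra
  then have "smult a (u n^8) = smult b (k n)" for n
    by (simp add: u_def k_def monom_power smult_monom algebra_simps)
  moreover have "u n \<noteq> 0" and k0: "poly (k n) 0 = 0" for n
    using assms by (simp_all add: u_def k_def poly_monom)
  moreover have "2 dvd k n" "u n dvd k n" for n
  proof -
    have "k n = 2 * monom (2^7 * a * b^7) (8 * Suc n)"
      by (simp add: k_def numeral_poly smult_monom)
    then show "2 dvd k n"
      by simp
    have "k n = u n * monom (2^7 * a * b^6) (7 * Suc n)"
      by (simp add: k_def u_def mult_monom power_numeral_reduce)
    then show "u n dvd k n"
      by simp
  qed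
  ultimately have "sol n \<in> ?S" for n
    unfolding sol_def mem_Collect_eq prod.case
    by (intro conjI is_solution_2848 nontrivial_2848 coprime4I_yw coprime_2848)
  then have "range sol \<subseteq> ?S"
    by (rule image_subsetI)
  moreover have "inj sol"
  proof (rule injI)
    fix m n assume "sol m = sol n"
    then have "k m^2 + 14*k m + 1 = k n^2 + 14*k n + 1"
      by (simp only: sol_def prod.inject)
    \<comment> \<open>Equal \<open>w\<close> leave two cases; the second factor has value 14 at 0,
      hence is nonzero.\<close>
    then have "(k m - k n) * (k m + k n + 14) = 0"
      by algebra
    moreover have "poly (k m + k n + 14) 0 \<noteq> poly 0 0"
      by (simp add: k0)
    then have "k m + k n + 14 \<noteq> 0"
      by metis
    ultimately have "k m = k n"
      by simp
    then have "degree (k m) = degree (k n)"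
      by simp
    then show "m = n"
      using assms by (simp add: k_def degree_monom_eq)
  qed
  ultimately show ?thesis
    using finite_subset range_inj_infinite by blast
qed

theorem theorem3p2:
  fixes a b :: int and p q r s :: nat
  assumes "a \<noteq> 0" and "b \<noteq> 0"
    and "(p, q, r, s) \<in> {(2, 4, 8, 8), (2, 8, 4, 8)}"
  shows "infinite {(x, y, z, w).
    is_solution a b p q r s x y z w \<and> \<not> trivial_solution p q r s x y z w \<and> coprime4 x y z w}"
  using assms(3) infinite_solutions_2488[OF assms(1,2)] infinite_solutions_2848[OF assms(1,2)]
  by auto

end
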